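(* Let $\mathcal{C}_0\supset\mathcal{C}$ be an open convex set in $\mathcal{L}_n$, and let $\mathcal{F}:\mathcal{C}_0\to\mathcal{L}_n$ (of the form $\mathcal{F}(x(\cdot))(\xi)=F(x(\xi),\xi)$) be continuously differentiable and pseudomonotone on $\mathcal{C}_0$. Let $D\hat{F}(x)$ be symmetric for all $x\in\phi(\mathcal{C}_0)$. If $e_2>0$ satisfies the condition that the multiplicity of the minimum eigenvalue of $D\hat{F}(x)+e_2P_{\phi(\mathcal{M}_n)}$ is strictly larger than one for all $x\in\phi(\mathcal{C}_0)$, then the monotonicity of $\mathcal{F}+N_{\mathcal{C}}$ is globally elicited at every level $s\ge e_2$.
   Context: Let $N\ge1$ and $n_1,\dots,n_N\ge 1$ be integers, $n=\sum_{k=1}^N n_k$. Let $\Xi=\Xi_1\times\cdots\times\Xi_N=\{\xi^1,\dots,\xi^J\}$ be a finite sample space whose elements $\xi=(\xi_1,\dots,\xi_N)$ have probabilities $p(\xi)>0$ summing to $1$. $\mathcal{L}_n$ is the Hilbert space of all maps $x(\cdot):\Xi\to\mathbb{R}^n$, $x(\xi)=(x_1(\xi),\dots,x_N(\xi))$ with $x_k(\xi)\in\mathbb{R}^{n_k}$, with inner product $\langle x(\cdot),w(\cdot)\rangle=\sum_{\xi\in\Xi}p(\xi)\sum_{k=1}^N\langle x_k(\xi),w_k(\xi)\rangle$. Let $\mathcal{N}_n=\{x(\cdot)\in\mathcal{L}_n: x_k(\xi)\text{ does not depend on }\xi_k,\dots,\xi_N,\ k=1,\dots,N\}$, and let $\mathcal{M}_n=\{w(\cdot)\in\mathcal{L}_n:E_{\xi|\xi_1,\dots,\xi_{k-1}}w_k(\xi)=0,\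 k=1,\dots,N\}$ be its orthogonal complement. For each $\xi$ let $C(\xi)\subset\mathbb{R}^n$ be nonempty closed convex, and $\mathcal{C}=\{x(\cdot)\in\mathcal{L}_n:x(\xi)\in C(\xi)\ \forall\xi\in\Xi\}$. $\mathcal{F}$ is given by $\mathcal{F}(x(\cdot)):\xi\mapsto F(x(\xi),\xi)$, with $F(\cdot,\xi)$ a function from $\mathbb{R}^n$ to $\mathbb{R}^n$. $\mathcal{F}$ is pseudomonotone on $\mathcal{K}\subset\mathcal{L}_n$ if for all $x(\cdot),y(\cdot)\in\mathcal{K}$: $\langle y(\cdot)-x(\cdot),\mathcal{F}(x(\cdot))\rangle\ge0$ implies $\langle y(\cdot)-x(\cdot),\mathcal{F}(y(\cdot))\rangle\ge0$. Let $\bar n=nJ$ and $\phi:\mathcal{L}_n\to\mathbb{R}^{\bar n}$, $\phi(x(\cdot))=(x_{p_1}^T,\dots,x_{p_J}^T)^T$ with $x_{p_i}=\sqrt{p(\xi^i)}\,x(\xi^i)$ (a linear isometric isomorphism). Define $\hat F(x)=\big(\sqrt{p(\xi^i)}\,F(x_{p_i}/\sqrt{p(\xi^i)},\xi^i)\big)_{i=1}^J$ for $x=(x_{p_1}^T,\dots,x_{p_J}^T)^T$, so $\hat F(\phi(x(\cdot)))=\phi(\mathcal{F}(x(\cdot)))$. $D\hat F(x)$ is the Jacobian; $P_{\mathcal{M}_n}$ and $P_{\phi(\mathcal{M}_n)}$ are the orthogonal projections onto $\mathcal{M}_n$ and $\phi(\mathcal{M}_n)$ (the latter viewed as an $\bar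 n\times\bar n$ matrix). $N_{\mathcal{C}}(x(\cdot))=\{v(\cdot):\langle v(\cdot),y(\cdot)-x(\cdot)\rangle\le0\ \forall y(\cdot)\in\mathcal{C}\}$ for $x(\cdot)\in\mathcal{C}$, and $\emptyset$ for $x(\cdot)\notin\mathcal{C}$. The monotonicity of $\mathcal{F}+N_{\mathcal{C}}$ is (globally) elicited at level $s>0$ (with respect to $\mathcal{N}_n$) if the set-valued mapping $\mathcal{F}+N_{\mathcal{C}}+sP_{\mathcal{M}_n}$ is (globally) maximal monotone on $\mathcal{L}_n$. *)

theory Defs
  imports "HOL-Analysis.Analysis"
begin

text \<open>
  The sample space \<open>\<Xi> = \<Xi>\<^sub>1 \<times> \<dots> \<times> \<Xi>\<^sub>N = {\<xi>\<^sup>1, \<dots>, \<xi>\<^sup>J}\<close> is indexed by a finite type \<open>'s\<close> with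
  \<open>CARD('s) = J\<close>: the map \<open>xi :: 's \<Rightarrow> nat \<Rightarrow> 'a\<close> is to be a bijection onto
  \<open>Pi\<^sub>E {1..N} Xi\<close>, and \<open>xi s k\<close> is the component \<open>\<xi>\<^sub>k\<close> of the scenario \<open>s\<close>.

  The coordinates of \<open>\<real>\<^sup>n\<close> are indexed by a finite type \<open>'n\<close>, and \<open>stage :: 'n \<Rightarrow> nat\<close>, with
  range \<open>{1..N}\<close>, tells to which of the blocks \<open>x\<^sub>1, \<dots>, x\<^sub>N\<close> a coordinate belongs. Thus
  \<open>n\<^sub>k = card {i. stage i = k} \<ge> 1\<close> and \<open>CARD('n) = n\<^sub>1 + \<dots> + n\<^sub>N\<close>.

  The space of all maps from the sample space to \<open>\<real>\<^sup>n\<close> is \<open>real^'n^'s\<close>. Its topology is the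
  right one, but its library inner product is not: the inner product of the problem is weighted
  with the probabilities. This is why the notions below that refer to an inner product take it
  as a parameter \<open>ip\<close>.
\<close>

definition inner_w :: "('s \<Rightarrow> real) \<Rightarrow> real^'n^'s \<Rightarrow> real^'n^'s \<Rightarrow> real" where
  "inner_w p x w = (\<Sum>s\<in>UNIV. p s * (x $ s \<bullet> w $ s))"

definition same_history :: "('s \<Rightarrow> nat \<Rightarrow> 'a) \<Rightarrow> nat \<Rightarrow> 's \<Rightarrow> 's \<Rightarrow> bool" where
  "same_history xi k s t \<longleftrightarrow> (\<forall>l\<in>{1..<k}. xi t l = xi s l)"

text \<open>Conditional expectation of \<open>f\<close> given \<open>\<xi>\<^sub>1, \<dots>, \<xi>\<^bsub>k-1\<^esub>\<close>, as a function of the scenario.\<close>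

definition cond_expect ::
    "('s::finite \<Rightarrow> real) \<Rightarrow> ('s \<Rightarrow> nat \<Rightarrow> 'a) \<Rightarrow> nat \<Rightarrow> ('s \<Rightarrow> real) \<Rightarrow> 's \<Rightarrow> real" where
  "cond_expect p xi k f s =
     (\<Sum>t | same_history xi k s t. p t * f t) / (\<Sum>t | same_history xi k s t. p t)"

definition nonanticipative ::
    "nat \<Rightarrow> ('n \<Rightarrow> nat) \<Rightarrow> ('s \<Rightarrow> nat \<Rightarrow> 'a) \<Rightarrow> (real^'n^'s) set" where
  "nonanticipative N stage xi =
     {x. \<forall>k\<in>{1..N}. \<forall>i. stage i = k \<longrightarrow> (\<forall>s t. same_history xi k s t \<longrightarrow> x $ s $ i = x $ t $ i)}"

definition multipliers ::
    "nat \<Rightarrow> ('n \<Rightarrow> nat) \<Rightarrow> ('s \<Rightarrow> real) \<Rightarrow> ('s::finite \<Rightarrow> nat \<Rightarrow> 'a) \<Rightarrow> (real^'n^'s) set" where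
  "multipliers N stage p xi =
     {w. \<forall>k\<in>{1..N}. \<forall>i. stage i = k \<longrightarrow> (\<forall>s. cond_expect p xi k (\<lambda>t. w $ t $ i) s = 0)}"

definition constraint_set :: "('s \<Rightarrow> (real^'n) set) \<Rightarrow> (real^'n^'s) set" where
  "constraint_set C = {x. \<forall>s. x $ s \<in> C s}"

definition superpos :: "(real^'n \<Rightarrow> 's \<Rightarrow> real^'n) \<Rightarrow> real^'n^'s \<Rightarrow> real^'n^'s" where
  "superpos F x = (\<chi> s. F (x $ s) s)"

definition continuously_differentiable_on ::
    "('v::real_normed_vector \<Rightarrow> 'w::real_normed_vector) \<Rightarrow> 'v set \<Rightarrow> bool" where
  "continuously_differentiable_on f S \<longleftrightarrow>
     (\<exists>f'. (\<forall>x\<in>S. (f has_derivative blinfun_apply (f' x)) (at x)) \<and> continuous_on S f')"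

definition pseudomonotone_on ::
    "('v \<Rightarrow> 'v \<Rightarrow> real) \<Rightarrow> 'v set \<Rightarrow> ('v \<Rightarrow> 'v::real_vector) \<Rightarrow> bool" where
  "pseudomonotone_on ip K f \<longleftrightarrow>
     (\<forall>x\<in>K. \<forall>y\<in>K. ip (y - x) (f x) \<ge> 0 \<longrightarrow> ip (y - x) (f y) \<ge> 0)"

definition orth_proj ::
    "('v \<Rightarrow> 'v \<Rightarrow> real) \<Rightarrow> 'v set \<Rightarrow> 'v \<Rightarrow> 'v::real_vector" where
  "orth_proj ip S x = (THE y. y \<in> S \<and> (\<forall>z\<in>S. ip (x - y) z = 0))"

definition normal_cone ::
    "('v \<Rightarrow> 'v \<Rightarrow> real) \<Rightarrow> 'v set \<Rightarrow> 'v \<Rightarrow> 'v::real_vector set" where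
  "normal_cone ip S x = (if x \<in> S then {v. \<forall>y\<in>S. ip v (y - x) \<le> 0} else {})"

definition monotone_map ::
    "('v \<Rightarrow> 'v \<Rightarrow> real) \<Rightarrow> ('v \<Rightarrow> 'v::real_vector set) \<Rightarrow> bool" where
  "monotone_map ip T \<longleftrightarrow> (\<forall>x y. \<forall>u\<in>T x. \<forall>v\<in>T y. ip (y - x) (v - u) \<ge> 0)"

definition maximal_monotone_map ::
    "('v \<Rightarrow> 'v \<Rightarrow> real) \<Rightarrow> ('v \<Rightarrow> 'v::real_vector set) \<Rightarrow> bool" where
  "maximal_monotone_map ip T \<longleftrightarrow>
     monotone_map ip T \<and> (\<forall>T'. monotone_map ip T' \<and> (\<forall>x. T x \<subseteq> T' x) \<longrightarrow> T' = T)"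

text \<open>
  Global elicitation of the monotonicity of \<open>T\<close> at level \<open>s\<close> with respect to a subspace whose
  orthogonal complement is \<open>M\<close>.
\<close>

definition globally_elicited ::
    "('v \<Rightarrow> 'v \<Rightarrow> real) \<Rightarrow> 'v set \<Rightarrow> ('v \<Rightarrow> 'v::real_vector set) \<Rightarrow> real \<Rightarrow> bool" where
  "globally_elicited ip M T s \<longleftrightarrow>
     s > 0 \<and> maximal_monotone_map ip (\<lambda>x. {u + s *\<^sub>R orth_proj ip M x | u. u \<in> T x})"

text \<open>
  The isometry onto \<open>\<real>\<^bsup>nJ\<^esup>\<close>, whose coordinates are indexed by \<open>'s \<times> 'n\<close>; the target carries the
  usual inner product.
\<close>

definition phi :: "('s::finite \<Rightarrow> real) \<Rightarrow> real^'n^'s \<Rightarrow> real^('s \<times> 'n)" where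
  "phi p x = (\<chi> r. sqrt (p (fst r)) * x $ fst r $ snd r)"

definition Fhat ::
    "('s::finite \<Rightarrow> real) \<Rightarrow> (real^'n \<Rightarrow> 's \<Rightarrow> real^'n) \<Rightarrow> real^('s \<times> 'n) \<Rightarrow> real^('s \<times> 'n)" where
  "Fhat p F x = (\<chi> r. let s = fst r; i = snd r in
                  sqrt (p s) * F (\<chi> j. x $ (s, j) / sqrt (p s)) s $ i)"

definition eigenspace :: "real^'m^'m \<Rightarrow> real \<Rightarrow> (real^'m) set" where
  "eigenspace A l = {v. A *v v = l *\<^sub>R v}"

definition eigenvalues :: "real^'m^'m \<Rightarrow> real set" where
  "eigenvalues A = {l. \<exists>v\<in>eigenspace A l. v \<noteq> 0}"

definition min_eigenvalue :: "real^'m^'m \<Rightarrow> real" where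
  "min_eigenvalue A = Min (eigenvalues A)"

text \<open>
  Only used for symmetric matrices, for which the dimension of the eigenspace is also the
  multiplicity as a root of the characteristic polynomial.
\<close>

definition eigen_multiplicity :: "real^'m^'m \<Rightarrow> real \<Rightarrow> nat" where
  "eigen_multiplicity A l = dim (eigenspace A l)"


subsection \<open>Consistency of the definitions\<close>

lemma phi_isometry:
  assumes "\<And>s. p s > 0"
  shows "phi p x \<bullet> phi p (w :: real^'n^'s) = inner_w p x w"
proof -
  have "phi p x \<bullet> phi p w =
      (\<Sum>(s, i)\<in>UNIV \<times> UNIV. (sqrt (p s) * x $ s $ i) * (sqrt (p s) * w $ s $ i))"
    by (simp add: inner_vec_def phi_def case_prod_beta)
  also have "\<dots> = (\<Sum>s\<in>UNIV. \<Sum>i\<in>UNIV. (sqrt (p s) * sqrt (p s)) * (x $ s $ i * w $ s $ i))"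
    by (subst sum.cartesian_product [symmetric]) (intro sum.cong refl, simp only: mult_ac)
  also have "\<dots> = inner_w p x w"
    using assms by (simp add: inner_w_def inner_vec_def sum_distrib_left less_imp_le)
  finally show ?thesis .
qed

lemma Fhat_phi:
  assumes "\<And>s. p s > 0"
  shows "Fhat p F (phi p x) = phi p (superpos F x)"
proof -
  have "sqrt (p s) \<noteq> 0" for s using assms[of s] by simp
  then show ?thesis by (simp add: Fhat_def phi_def superpos_def Let_def vec_eq_iff)
qed

lemma multipliers_eq_orthogonal_complement:
  fixes p :: "'s::finite \<Rightarrow> real" and stage :: "'n::finite \<Rightarrow> nat"
  assumes p: "\<And>s. p s > 0" and stage: "range stage = {1..N}"
  shows "multipliers N stage p xi = {w. \<forall>x\<in>nonanticipative N stage xi. inner_w p x w = 0}"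
proof -
  have st: "stage i \<in> {1..N}" for i using stage by auto
  have refl: "same_history xi k s s" for k s by (simp add: same_history_def)
  have pos: "(\<Sum>t | same_history xi k s t. p t) > 0" for k s
    by (rule sum_pos) (use p refl in auto)
  have ce: "cond_expect p xi k f s = 0 \<longleftrightarrow> (\<Sum>t | same_history xi k s t. p t * f t) = 0" for k f s
    using pos[of k s] by (simp add: cond_expect_def)
  have ip: "inner_w p x w = (\<Sum>i\<in>UNIV. \<Sum>s\<in>UNIV. x $ s $ i * (p s * w $ s $ i))" for x w :: "real^'n^'s"
    by (subst sum.swap) (simp add: inner_w_def inner_vec_def sum_distrib_left ac_simps)
  have "inner_w p x w = 0"
    if w: "w \<in> multipliers N stage p xi" and x: "x \<in> nonanticipative N stage xi" for x w
  proof -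
    have "(\<Sum>s\<in>UNIV. x $ s $ i * (p s * w $ s $ i)) = 0" for i
    proof -
      let ?g = "\<lambda>s. {t. same_history xi (stage i) s t}"
      have cls: "{t. ?g t = ?g s} = ?g s" for s
        unfolding same_history_def by (auto simp: set_eq_iff)
      have "(\<Sum>t | ?g t = ?g s. x $ t $ i * (p t * w $ t $ i)) = 0" for s
      proof -
        have "(\<Sum>t\<in>?g s. x $ t $ i * (p t * w $ t $ i)) = (\<Sum>t\<in>?g s. x $ s $ i * (p t * w $ t $ i))"
          using x st[of i] unfolding nonanticipative_def by (intro sum.cong) auto
        also have "\<dots> = 0"
          using w st[of i] unfolding multipliers_def ce by (auto simp: sum_distrib_left [symmetric])
        finally show ?thesis by (simp only: cls)
      qed
      then have "(\<Sum>c\<in>range ?g. \<Sum>t | t \<in> UNIV \<and> ?g t = c. x $ t $ i * (p t * w $ t $ i)) = 0"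
        by (intro sum.neutral) auto
      then show ?thesis
        by (subst sum.image_gen[where g = ?g]) auto
    qed
    then show ?thesis by (simp add: ip)
  qed
  moreover have "w \<in> multipliers N stage p xi"
    if w: "\<And>x. x \<in> nonanticipative N stage xi \<Longrightarrow> inner_w p x w = 0" for w
  proof -
    have "(\<Sum>t | same_history xi (stage i) s t. p t * w $ t $ i) = 0" for i s
    proof -
      define x :: "real^'n^'s" where
        "x = (\<chi> t j. if j = i \<and> same_history xi (stage i) s t then 1 else 0)"
      have "x \<in> nonanticipative N stage xi"
        unfolding nonanticipative_def
      proof (intro CollectI ballI allI impI)
        fix k j t u
        assume "stage j = k" and "same_history xi k t u"
        then have "same_history xi (stage j) s t = same_history xi (stage j) s u"
          by (simp add: same_history_def)
        then show "x $ t $ j = x $ u $ j" by (auto simp: x_def)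
      qed
      then have "0 = inner_w p x w" using w by simp
      also have "\<dots> = (\<Sum>j\<in>UNIV. if j = i then
          (\<Sum>t\<in>UNIV. if same_history xi (stage i) s t then p t * w $ t $ i else 0) else 0)"
        unfolding ip x_def by (intro sum.cong) (auto intro!: sum.cong sum.neutral)
      also have "\<dots> = (\<Sum>t | same_history xi (stage i) s t. p t * w $ t $ i)"
        by (simp add: sum.If_cases)
      finally show ?thesis by simp
    qed
    then show ?thesis by (auto simp: multipliers_def ce)
  qed
  ultimately show ?thesis by blast
qed

end

theory Submission
  imports Defs
begin

text \<open>
  Write \<open>A x\<close> for the Jacobian of \<open>Fhat\<close> at \<open>x\<close> plus \<open>e2\<close> times the projection onto \<open>phi ` multipliers\<close>.
  The argument shows that \<open>A x\<close> is positive semidefinite; everything else follows from that.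

  Pseudomonotonicity of a differentiable map says, to first order at a point \<open>z\<close>, that the quadratic
  form of its derivative is nonnegative on the hyperplane orthogonal to the value of the map at \<open>z\<close>
  (\<open>pseudomonotone_derivative_nonneg\<close>; the case of the value \<open>0\<close> is included, where the hyperplane
  is the whole space). Adding a projection keeps this. A symmetric matrix whose least eigenvalue is
  negative with a two-dimensional eigenspace would take a negative value on that hyperplane, since
  the eigenspace meets it outside \<open>0\<close>. As the least eigenvalue of \<open>A x\<close> is multiple, it is
  nonnegative (\<open>positive_semidefinite_if_on_hyperplane\<close>).

  Hence, for \<open>s \<ge> e2\<close>, the derivative of the superposition operator plus \<open>s\<close> times the projection
  onto the multipliers has a nonnegative quadratic form, and on the convex set \<open>C0\<close> this makes the
  map monotone (\<open>monotone_if_derivative_nonneg\<close>). A continuous monotone map plus the normal cone of a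
  nonempty closed convex set is maximal monotone (\<open>maximal_monotone_add_normal_cone\<close>), by Minty's
  argument: the strongly monotone variational inequality that it requires is solved with Brouwer's
  fixed point theorem.

  The isometry \<open>phi\<close> translates between the weighted inner product, in which monotonicity is
  stated, and the usual one, in which the Jacobian and its eigenvalues live.
\<close>

section \<open>Symmetric matrices\<close>

lemma symmetric_matrix_inner:
  fixes A :: "real^'m^'m"
  assumes "transpose A = A"
  shows "x \<bullet> (A *v y) = (A *v x) \<bullet> y"
  by (metis assms dot_lmul_matrix transpose_matrix_vector)

text \<open>
  Eigenvectors for distinct eigenvalues are orthogonal, and there are only finitely many pairwise
  orthogonal nonzero vectors. Finiteness is what gives the \<open>Min\<close> in \<open>min_eigenvalue\<close> its meaning.
\<close>

lemma finite_eigenvalues: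
  fixes A :: "real^'m^'m"
  assumes sym: "transpose A = A"
  shows "finite (eigenvalues A)"
proof -
  have "\<forall>l\<in>eigenvalues A. \<exists>v. A *v v = l *\<^sub>R v \<and> v \<noteq> 0"
    by (auto simp: eigenvalues_def eigenspace_def)
  then obtain e where e: "\<And>l. l \<in> eigenvalues A \<Longrightarrow> A *v e l = l *\<^sub>R e l \<and> e l \<noteq> 0"
    by metis
  have orth: "e l \<bullet> e m = 0" if l: "l \<in> eigenvalues A" and m: "m \<in> eigenvalues A" and "l \<noteq> m" for l m
  proof -
    have "m * (e l \<bullet> e m) = l * (e l \<bullet> e m)"
      using symmetric_matrix_inner[OF sym, of "e l" "e m"] e[OF l] e[OF m] by simp
    then show ?thesis using \<open>l \<noteq> m\<close> by simp
  qed
  have "pairwise orthogonal (e ` eigenvalues A)"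
    using orth unfolding pairwise_def orthogonal_def by (metis imageE)
  then have "finite (e ` eigenvalues A)"
    by (rule pairwise_orthogonal_imp_finite)
  moreover have "inj_on e (eigenvalues A)"
    by (rule inj_onI) (metis e inner_eq_zero_iff orth)
  ultimately show ?thesis by (rule finite_imageD)
qed

lemma linear_part_zero_if_nonneg_quadratic:
  fixes a b :: real
  assumes "\<And>t. 0 \<le> a * t + b * t\<^sup>2"
  shows "a = 0"
proof (rule ccontr)
  assume "a \<noteq> 0"
  \<comment> \<open>Opposite in sign to \<open>a\<close>, and so small that the quadratic term cannot compensate.\<close>
  define t where "t = - a / (\<bar>b\<bar> + 1)"
  have t: "a = - t * (\<bar>b\<bar> + 1)" by (simp add: t_def)
  have "t \<noteq> 0" using \<open>a \<noteq> 0\<close> t by auto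
  have "a * t + b * t\<^sup>2 = (b - \<bar>b\<bar> - 1) * t\<^sup>2"
    by (subst t) (simp add: algebra_simps power2_eq_square)
  also have "\<dots> < 0" using \<open>t \<noteq> 0\<close> by (intro mult_neg_pos) auto
  finally show False using assms[of t] by simp
qed

text \<open>
  A minimiser of the Rayleigh quotient over the unit sphere is an eigenvector, because the
  nonnegative quadratic form of \<open>A - \<mu> I\<close> is stationary where it vanishes; so the minimum is an
  eigenvalue.
\<close>

lemma min_eigenvalue_le_quadratic_form:
  fixes A :: "real^'m^'m"
  assumes sym: "transpose A = A"
  shows "min_eigenvalue A * (v \<bullet> v) \<le> v \<bullet> (A *v v)"
proof -
  have "continuous_on (sphere 0 1) (\<lambda>x. x \<bullet> (A *v x))"
    by (intro continuous_on_inner continuous_on_id matrix_vector_mult_linear_continuous_on)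
  moreover have "sphere (0 :: real^'m) 1 \<noteq> {}" by simp
  ultimately obtain u :: "real^'m" where u: "u \<in> sphere 0 1"
    and min: "\<And>x. x \<in> sphere 0 1 \<Longrightarrow> u \<bullet> (A *v u) \<le> x \<bullet> (A *v x)"
    using continuous_attains_inf[OF compact_sphere, of 0 1 "\<lambda>x :: real^'m. x \<bullet> (A *v x)"] by blast
  define \<mu> where "\<mu> = u \<bullet> (A *v u)"
  have uu: "u \<bullet> u = 1" using u by (simp add: dot_square_norm)
  have nonneg: "\<mu> * (x \<bullet> x) \<le> x \<bullet> (A *v x)" for x
  proof (cases "x = 0")
    case False
    then have "\<mu> \<le> (x /\<^sub>R norm x) \<bullet> (A *v (x /\<^sub>R norm x))"
      unfolding \<mu>_def by (intro min) simp
    also have "\<dots> = (x \<bullet> (A *v x)) / (x \<bullet> x)"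
      by (simp add: linear_cmul[OF matrix_vector_mul_linear] divide_inverse dot_square_norm power2_eq_square)
    finally show ?thesis using False by (simp add: field_simps)
  qed simp
  define w where "w = A *v u - \<mu> *\<^sub>R u"
  have "2 * (w \<bullet> w) = 0"
  proof (rule linear_part_zero_if_nonneg_quadratic)
    fix t :: real
    have "0 \<le> (u + t *\<^sub>R w) \<bullet> (A *v (u + t *\<^sub>R w)) - \<mu> * ((u + t *\<^sub>R w) \<bullet> (u + t *\<^sub>R w))"
      using nonneg by simp
    also have "\<dots> = (u \<bullet> (A *v u) - \<mu> * (u \<bullet> u)) + t * (u \<bullet> (A *v w) + w \<bullet> (A *v u) - 2 * \<mu> * (u \<bullet> w))
        + t\<^sup>2 * (w \<bullet> (A *v w) - \<mu> * (w \<bullet> w))"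
      by (simp add: linear_add[OF matrix_vector_mul_linear] linear_cmul[OF matrix_vector_mul_linear]
          inner_add_left inner_add_right inner_commute[of w u] algebra_simps power2_eq_square)
    also have "u \<bullet> (A *v u) - \<mu> * (u \<bullet> u) = 0" by (simp add: uu \<mu>_def)
    also have "u \<bullet> (A *v w) + w \<bullet> (A *v u) - 2 * \<mu> * (u \<bullet> w) = 2 * (w \<bullet> w)"
    proof -
      have "u \<bullet> (A *v w) = w \<bullet> (A *v u)"
        by (metis symmetric_matrix_inner[OF sym] inner_commute)
      moreover have "w \<bullet> w = w \<bullet> (A *v u) - \<mu> * (w \<bullet> u)"
        by (subst (2) w_def) (simp add: inner_diff_right)
      ultimately show ?thesis by (simp add: inner_commute)
    qed
    finally show "0 \<le> 2 * (w \<bullet> w) * t + (w \<bullet> (A *v w) - \<mu> * (w \<bullet> w)) * t\<^sup>2"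
      by (simp add: mult.commute)
  qed
  then have "\<mu> \<in> eigenvalues A"
    using uu by (auto simp: eigenvalues_def eigenspace_def w_def intro!: bexI[of _ u])
  then have "min_eigenvalue A \<le> \<mu>"
    unfolding min_eigenvalue_def by (intro Min_le finite_eigenvalues[OF sym])
  then have "min_eigenvalue A * (v \<bullet> v) \<le> \<mu> * (v \<bullet> v)" by (intro mult_right_mono inner_ge_zero)
  then show ?thesis using nonneg[of v] by simp
qed

text \<open>Otherwise the functional \<open>a \<bullet> v\<close> would embed \<open>E\<close> into the reals.\<close>

lemma dim_gt_1_meets_hyperplane:
  fixes E :: "'v::euclidean_space set"
  assumes "subspace E" and "dim E > 1"
  obtains (thesisI) v where "v \<in> E" "v \<noteq> 0" "a \<bullet> v = 0"
proof (rule ccontr)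
  assume "\<not> thesis"
  then have none: "v = 0" if "v \<in> E" "a \<bullet> v = 0" for v using that \<open>\<not> thesis\<close> thesisI by blast
  have lin: "linear (\<lambda>v. a \<bullet> v)" by (simp add: bounded_linear.linear bounded_linear_inner_right)
  have "inj_on (\<lambda>v. a \<bullet> v) (span E)"
    using none assms(1) by (auto simp: linear_inj_on_iff_eq_0[OF lin] span_eq_iff[THEN iffD2])
  then have "dim ((\<lambda>v. a \<bullet> v) ` E) = dim E" by (rule dim_image_eq[OF lin])
  then show False using assms(2) dim_subset_UNIV[of "(\<lambda>v. a \<bullet> v) ` E"] by simp
qed

text \<open>
  The eigenspace of the least eigenvalue has dimension at least two, so it contains a nonzero vector
  of the hyperplane. There the quadratic form is nonnegative and has the sign of that eigenvalue, so
  no eigenvalue is negative.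
\<close>

lemma positive_semidefinite_if_on_hyperplane:
  fixes A :: "real^'m^'m"
  assumes sym: "transpose A = A"
    and mult: "eigen_multiplicity A (min_eigenvalue A) > 1"
    and hyp: "\<And>v. a \<bullet> v = 0 \<Longrightarrow> 0 \<le> v \<bullet> (A *v v)"
  shows "0 \<le> v \<bullet> (A *v v)"
proof -
  let ?l = "min_eigenvalue A"
  have "subspace (eigenspace A ?l)"
    unfolding subspace_def eigenspace_def
    by (auto simp: linear_add[OF matrix_vector_mul_linear] linear_cmul[OF matrix_vector_mul_linear]
        algebra_simps)
  then obtain u where u: "u \<in> eigenspace A ?l" "u \<noteq> 0" "a \<bullet> u = 0"
    using mult dim_gt_1_meets_hyperplane unfolding eigen_multiplicity_def by metis
  have "0 \<le> ?l * (u \<bullet> u)" using hyp[OF u(3)] u(1) by (simp add: eigenspace_def)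
  then have "0 \<le> ?l" using u(2) by (metis inner_gt_zero_iff zero_le_mult_iff not_le)
  then have "0 \<le> ?l * (v \<bullet> v)" by simp
  also have "\<dots> \<le> v \<bullet> (A *v v)" by (rule min_eigenvalue_le_quadratic_form[OF sym])
  finally show ?thesis .
qed

section \<open>Orthogonal projections\<close>

lemma orth_proj_eq:
  fixes S :: "'v::euclidean_space set"
  assumes "subspace S" and "y \<in> S" and "\<And>z. z \<in> S \<Longrightarrow> (x - y) \<bullet> z = 0"
  shows "orth_proj (\<bullet>) S x = y"
  unfolding orth_proj_def
proof (rule the_equality)
  fix y' assume y': "y' \<in> S \<and> (\<forall>z\<in>S. (x - y') \<bullet> z = 0)"
  have "y' - y \<in> S" using y' assms(1,2) by (simp add: subspace_diff)
  then have "(y' - y) \<bullet> (y' - y) = 0"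
    using y' assms(3)[of "y' - y"] by (simp add: inner_diff_left)
  then show "y' = y" by simp
qed (use assms in auto)

lemma orth_proj_props:
  fixes S :: "'v::euclidean_space set"
  assumes "subspace S"
  shows "orth_proj (\<bullet>) S x \<in> S" and "z \<in> S \<Longrightarrow> (x - orth_proj (\<bullet>) S x) \<bullet> z = 0"
proof -
  obtain y w where yw: "y \<in> span S" "\<And>z. z \<in> span S \<Longrightarrow> orthogonal w z" "x = y + w"
    using orthogonal_subspace_decomp_exists[of S x] by metis
  then have "y \<in> S" and orth: "\<And>z. z \<in> S \<Longrightarrow> (x - y) \<bullet> z = 0"
    using assms by (auto simp: orthogonal_def span_eq_iff[THEN iffD2])
  then have "orth_proj (\<bullet>) S x = y" using assms by (intro orth_proj_eq)
  then show "orth_proj (\<bullet>) S x \<in> S" "z \<in> S \<Longrightarrow> (x - orth_proj (\<bullet>) S x) \<bullet> z = 0"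
    using \<open>y \<in> S\<close> orth by auto
qed

lemma linear_orth_proj:
  fixes S :: "'v::euclidean_space set"
  assumes S: "subspace S"
  shows "linear (orth_proj (\<bullet>) S)"
proof (rule linearI)
  fix x y :: 'v and c :: real
  note P = orth_proj_props[OF S]
  show "orth_proj (\<bullet>) S (x + y) = orth_proj (\<bullet>) S x + orth_proj (\<bullet>) S y"
  proof (rule orth_proj_eq[OF S])
    fix z assume "z \<in> S"
    then show "(x + y - (orth_proj (\<bullet>) S x + orth_proj (\<bullet>) S y)) \<bullet> z = 0"
      using P(2)[of z x] P(2)[of z y] by (simp add: algebra_simps)
  qed (use S P(1) in \<open>simp add: subspace_add\<close>)
  show "orth_proj (\<bullet>) S (c *\<^sub>R x) = c *\<^sub>R orth_proj (\<bullet>) S x"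
  proof (rule orth_proj_eq[OF S])
    fix z assume "z \<in> S"
    then show "(c *\<^sub>R x - c *\<^sub>R orth_proj (\<bullet>) S x) \<bullet> z = 0"
      using P(2)[of z x] by (simp add: inner_diff_left)
  qed (use S P(1) in \<open>simp add: subspace_scale\<close>)
qed

lemma orth_proj_self_adjoint:
  fixes S :: "'v::euclidean_space set"
  assumes S: "subspace S"
  shows "x \<bullet> orth_proj (\<bullet>) S y = orth_proj (\<bullet>) S x \<bullet> orth_proj (\<bullet>) S y"
  using orth_proj_props(2)[OF S orth_proj_props(1)[OF S], of x y] by (simp add: inner_diff_left)

lemma transpose_matrix_orth_proj:
  fixes S :: "(real^'m) set"
  assumes S: "subspace S"
  shows "transpose (matrix (orth_proj (\<bullet>) S)) = matrix (orth_proj (\<bullet>) S)"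
proof -
  have "adjoint (orth_proj (\<bullet>) S) = orth_proj (\<bullet>) S"
    using orth_proj_self_adjoint[OF S] by (intro adjoint_unique) (metis inner_commute)
  then show ?thesis using matrix_adjoint[OF linear_orth_proj[OF S]] by simp
qed

text \<open>
  An isometry \<open>\<Phi>\<close> from an arbitrary inner product to the usual one carries projections to
  projections, so the projection for the weighted inner product exists as well.
\<close>

lemma orth_proj_isometry:
  fixes \<Phi> :: "'v::real_vector \<Rightarrow> 'w::euclidean_space"
  assumes iso: "\<And>x y. \<Phi> x \<bullet> \<Phi> y = ip x y" and lin: "linear \<Phi>" and inj: "inj \<Phi>"
    and S: "subspace S"
  shows "\<Phi> (orth_proj ip S x) = orth_proj (\<bullet>) (\<Phi> ` S) (\<Phi> x)"
proof -
  have sub: "subspace (\<Phi> ` S)" by (rule linear_subspace_image[OF lin S])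
  obtain y where y: "y \<in> S" "orth_proj (\<bullet>) (\<Phi> ` S) (\<Phi> x) = \<Phi> y"
    using orth_proj_props(1)[OF sub] by blast
  have "orth_proj ip S x = y"
    unfolding orth_proj_def
  proof (rule the_equality)
    show "y \<in> S \<and> (\<forall>z\<in>S. ip (x - y) z = 0)"
      using y orth_proj_props(2)[OF sub, of _ "\<Phi> x"]
      by (auto simp: iso[symmetric] linear_diff[OF lin])
  next
    fix y' assume y': "y' \<in> S \<and> (\<forall>z\<in>S. ip (x - y') z = 0)"
    have "orth_proj (\<bullet>) (\<Phi> ` S) (\<Phi> x) = \<Phi> y'"
      using y' by (intro orth_proj_eq[OF sub]) (auto simp: iso linear_diff[OF lin, symmetric])
    then show "y' = y" using y(2) inj by (simp add: inj_eq)
  qed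
  then show ?thesis using y(2) by simp
qed

section \<open>Maximal monotonicity with a normal cone\<close>

text \<open>
  The solutions of this variational inequality (Hartman and Stampacchia) are the fixed points of
  \<open>x \<mapsto> closest_point K (x - H x)\<close>, and one exists by Brouwer's theorem.
\<close>

lemma variational_inequality_compact:
  fixes H :: "'v::euclidean_space \<Rightarrow> 'v"
  assumes "compact K" "convex K" "K \<noteq> {}" and H: "continuous_on K H"
  obtains x where "x \<in> K" "\<And>z. z \<in> K \<Longrightarrow> 0 \<le> H x \<bullet> (z - x)"
proof -
  note cl = compact_imp_closed[OF assms(1)]
  let ?f = "\<lambda>x. closest_point K (x - H x)"
  have "continuous_on K ?f"
    by (rule continuous_on_compose2[OF continuous_on_closest_point[OF assms(2) cl assms(3), of UNIV]])
      (auto intro!: continuous_intros H)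
  moreover have "?f \<in> K \<rightarrow> K" using closest_point_in_set[OF cl assms(3)] by auto
  ultimately obtain x where x: "x \<in> K" "?f x = x" using brouwer[OF assms(1,2,3), of ?f] by blast
  have "0 \<le> H x \<bullet> (z - x)" if "z \<in> K" for z
    using closest_point_dot[OF assms(2) cl that, of "x - H x"] x(2) by simp
  then show ?thesis using that x(1) by blast
qed

text \<open>
  On an unbounded set, the variational inequality is solved on its intersection with a large ball;
  if no solution can lie on the boundary sphere, then the solution found is one on the whole set,
  since every \<open>z\<close> in the set is seen from it in a direction that starts inside the ball.
\<close>

lemma variational_inequality_coercive:
  fixes H :: "'v::euclidean_space \<Rightarrow> 'v"
  assumes K: "closed K" "convex K" and x0: "x0 \<in> K" and H: "continuous_on K H"
    and coercive: "\<And>x. x \<in> K \<Longrightarrow> 0 \<le> H x \<bullet> (x0 - x) \<Longrightarrow> norm (x - x0) \<le> r"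
  obtains x where "x \<in> K" "\<And>z. z \<in> K \<Longrightarrow> 0 \<le> H x \<bullet> (z - x)"
proof -
  let ?R = "r + 1"
  have "0 \<le> r" using coercive[OF x0] by simp
  let ?K = "K \<inter> cball x0 ?R"
  have "compact ?K" "convex ?K" "x0 \<in> ?K" "continuous_on ?K H"
    using K x0 \<open>0 \<le> r\<close> by (auto intro: closed_Int_compact convex_Int continuous_on_subset[OF H])
  then obtain x where x: "x \<in> ?K" "\<And>z. z \<in> ?K \<Longrightarrow> 0 \<le> H x \<bullet> (z - x)"
    using variational_inequality_compact by (metis empty_iff)
  have close: "norm (x - x0) \<le> r" using coercive x \<open>x0 \<in> ?K\<close> by blast
  have "0 \<le> H x \<bullet> (z - x)" if z: "z \<in> K" for z
  proof -
    \<comment> \<open>A step towards \<open>z\<close> of length at most \<open>1\<close>, the difference between the two radii.\<close>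
    define t where "t = 1 / (norm (z - x) + 1)"
    have t: "0 < t" "t \<le> 1" "t * norm (z - x) \<le> 1"
      by (auto simp: t_def field_simps add_pos_nonneg)
    have "x + t *\<^sub>R (z - x) \<in> K"
      using convexD_alt[OF K(2) _ z, of x t] x(1) t by (simp add: algebra_simps)
    moreover have "norm (x + t *\<^sub>R (z - x) - x0) \<le> ?R"
    proof -
      have "x + t *\<^sub>R (z - x) - x0 = (x - x0) + t *\<^sub>R (z - x)" by simp
      also have "norm \<dots> \<le> norm (x - x0) + norm (t *\<^sub>R (z - x))" by (rule norm_triangle_ineq)
      also have "\<dots> \<le> ?R" using close t by simp
      finally show ?thesis .
    qed
    ultimately have "0 \<le> H x \<bullet> (x + t *\<^sub>R (z - x) - x)"
      by (intro x(2)) (simp add: dist_norm norm_minus_commute)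
    then show ?thesis using t(1) by (simp add: zero_le_mult_iff)
  qed
  then show ?thesis using that x(1) by blast
qed

text \<open>
  The operator \<open>W\<close> represents the inner product \<open>ip\<close> in terms of the usual one; it turns the
  variational inequality for \<open>ip\<close> into a usual one. Maximality is Minty's argument: if \<open>(y, w)\<close> is
  monotonically related to the graph, solve \<open>x + G x + v = y + w\<close> with \<open>v\<close> normal at \<open>x\<close>. The
  relation then reads \<open>ip (y - x) (x - y) \<ge> 0\<close>, which forces \<open>x = y\<close>, so that \<open>(y, w)\<close> lies in the
  graph already.
\<close>

lemma maximal_monotone_add_normal_cone:
  fixes G :: "'v::euclidean_space \<Rightarrow> 'v"
  assumes W: "linear W" and ip: "\<And>x y. ip x y = W x \<bullet> y" and sym: "\<And>x y. ip x y = ip y x"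
    and c: "c > 0" "\<And>x. c * (norm x)\<^sup>2 \<le> ip x x"
    and C: "closed C" "convex C" "C \<noteq> {}" and G: "continuous_on C G"
    and mono: "\<And>x y. x \<in> C \<Longrightarrow> y \<in> C \<Longrightarrow> 0 \<le> ip (y - x) (G y - G x)"
  shows "maximal_monotone_map ip (\<lambda>x. {G x + v | v. v \<in> normal_cone ip C x})"
    (is "maximal_monotone_map ip ?T")
proof -
  note ip_simps = ip linear_add[OF W] linear_diff[OF W] inner_add_left inner_add_right
    inner_diff_left inner_diff_right
  have monoT: "monotone_map ip ?T"
    unfolding monotone_map_def
  proof (intro allI ballI)
    fix x y a b assume "a \<in> ?T x" "b \<in> ?T y"
    then obtain u v where u: "a = G x + u" "u \<in> normal_cone ip C x"
      and v: "b = G y + v" "v \<in> normal_cone ip C y" by auto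
    have xy: "x \<in> C" "y \<in> C" using u v by (auto simp: normal_cone_def split: if_splits)
    have "ip u (y - x) \<le> 0" "ip v (x - y) \<le> 0"
      using u v xy by (auto simp: normal_cone_def)
    moreover have "ip (y - x) (b - a) = ip (y - x) (G y - G x) - ip (y - x) u - ip (x - y) v"
      unfolding u v by (simp add: ip_simps)
    ultimately show "0 \<le> ip (y - x) (b - a)"
      using mono[OF xy] by (simp add: sym[of u] sym[of v])
  qed
  have "w \<in> ?T y" if rel: "\<And>x u. u \<in> ?T x \<Longrightarrow> 0 \<le> ip (y - x) (w - u)" for y w
  proof -
    obtain x0 where x0: "x0 \<in> C" using C by blast
    define h where "h = (\<lambda>x. x + G x - y - w)"
    \<comment> \<open>The map \<open>h\<close> is strongly monotone, which confines the solutions to a ball around \<open>x0\<close>.\<close>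
    define r where "r = norm (W (h x0)) / c"
    have "continuous_on C (\<lambda>x. W (h x))"
      unfolding h_def
      by (intro linear_continuous_on_compose[OF _ W] continuous_intros G)
    moreover have "norm (x - x0) \<le> r" if x: "x \<in> C" and le: "0 \<le> W (h x) \<bullet> (x0 - x)" for x
    proof (cases "x = x0")
      case False
      let ?d = "x - x0"
      have "W (h x) \<bullet> (x0 - x) = - ip ?d ?d - ip (G x - G x0) ?d - W (h x0) \<bullet> ?d"
        unfolding h_def by (simp add: ip_simps)
      moreover have "0 \<le> ip (G x - G x0) ?d" using mono[OF x0 x] by (simp add: sym)
      ultimately have "ip ?d ?d \<le> - (W (h x0) \<bullet> ?d)" using le by simp
      also have "\<dots> \<le> norm (W (h x0)) * norm ?d"
        using Cauchy_Schwarz_ineq2[of "W (h x0)" ?d] by simp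
      finally have "c * norm ?d * norm ?d \<le> norm (W (h x0)) * norm ?d"
        using c(2)[of ?d] by (simp add: power2_eq_square mult.assoc)
      then have "c * norm ?d \<le> norm (W (h x0))" using False by simp
      then show ?thesis using c(1) by (simp add: r_def field_simps)
    qed (use c(1) in \<open>simp add: r_def\<close>)
    ultimately obtain x where x: "x \<in> C" "\<And>z. z \<in> C \<Longrightarrow> 0 \<le> W (h x) \<bullet> (z - x)"
      using variational_inequality_coercive[OF C(1,2) x0] by metis
    define v where "v = - h x"
    have "v \<in> normal_cone ip C x"
      using x by (simp add: normal_cone_def v_def ip linear_neg[OF W])
    then have v: "G x + v \<in> ?T x" by blast
    have w: "w = G x + v - (y - x)" by (simp add: v_def h_def)
    have "0 \<le> ip (y - x) (- (y - x))" using rel[OF v] by (simp add: w)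
    then have "c * (norm (y - x))\<^sup>2 \<le> 0"
      using c(2)[of "y - x"] by (simp only: ip inner_minus_right)
    then have "y = x" using c(1) by (simp add: mult_le_0_iff)
    then show ?thesis using v w by simp
  qed
  then have "T' = ?T" if "monotone_map ip T'" "\<forall>x. ?T x \<subseteq> T' x" for T'
    using that unfolding monotone_map_def by (intro ext) (smt (verit) subset_eq subset_antisym)
  then show ?thesis using monoT unfolding maximal_monotone_map_def by blast
qed

section \<open>Derivatives of pseudomonotone and monotone maps\<close>

text \<open>
  Along a direction \<open>v\<close> with \<open>ip v (f x) = 0\<close>, pseudomonotonicity makes \<open>t \<mapsto> ip v (f (x + t v))\<close>
  nonnegative for \<open>t > 0\<close>; it vanishes at \<open>0\<close>, so its derivative there is nonnegative.
\<close>

lemma pseudomonotone_derivative_nonneg: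
  fixes f :: "'v::real_normed_vector \<Rightarrow> 'v"
  assumes pm: "pseudomonotone_on ip K f" and K: "open K" and x: "x \<in> K"
    and f: "(f has_derivative f') (at x)"
    and ip: "bounded_bilinear ip" and v: "ip v (f x) = 0"
  shows "0 \<le> ip v (f' v)"
proof (rule ccontr)
  interpret bounded_bilinear ip by (rule ip)
  assume neg: "\<not> 0 \<le> ip v (f' v)"
  let ?g = "\<lambda>t. ip v (f (x + t *\<^sub>R v))"
  have line: "((\<lambda>t. x + t *\<^sub>R v) has_derivative (\<lambda>t. t *\<^sub>R v)) (at 0)"
    by (auto intro!: derivative_eq_intros)
  have "((\<lambda>t. f (x + t *\<^sub>R v)) has_derivative (\<lambda>t. f' (t *\<^sub>R v))) (at 0)"
    by (rule has_derivative_compose[OF line]) (simp add: f)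
  from bounded_linear.has_derivative[OF bounded_linear_right this, of v]
  have "(?g has_derivative (\<lambda>t. ip v (f' (t *\<^sub>R v)))) (at 0)" .
  moreover have "ip v (f' (t *\<^sub>R v)) = ip v (f' v) * t" for t
    by (simp add: linear_cmul[OF has_derivative_linear[OF f]] scaleR_right)
  ultimately have "(?g has_real_derivative ip v (f' v)) (at 0)"
    by (simp add: has_field_derivative_def)
  then obtain d where d: "d > 0" "\<And>h. 0 < h \<Longrightarrow> h < d \<Longrightarrow> ?g h < 0"
    using DERIV_neg_dec_right[of ?g "ip v (f' v)" 0] neg v by auto
  have "isCont (\<lambda>t::real. x + t *\<^sub>R v) 0" by (intro continuous_intros)
  then have "\<forall>\<^sub>F t::real in at 0. x + t *\<^sub>R v \<in> K"
    using topological_tendstoD[of "\<lambda>t::real. x + t *\<^sub>R v" x "at 0" K] K x by (simp add: isCont_def)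
  then obtain e where e: "e > 0" "\<And>t::real. t \<noteq> 0 \<Longrightarrow> dist t 0 < e \<Longrightarrow> x + t *\<^sub>R v \<in> K"
    unfolding eventually_at by auto
  define t where "t = min d e / 2"
  have t: "0 < t" "t < d" "x + t *\<^sub>R v \<in> K" using d(1) e by (auto simp: t_def)
  have "0 \<le> ip (x + t *\<^sub>R v - x) (f (x + t *\<^sub>R v))"
    using pm[unfolded pseudomonotone_on_def, rule_format, OF x t(3)] v by (simp add: scaleR_left)
  then have "0 \<le> ?g t" using t(1) by (simp add: scaleR_left zero_le_mult_iff)
  then show False using d(2)[OF t(1,2)] by simp
qed

text \<open>
  Restricted to the segment from \<open>x\<close> to \<open>y\<close> and paired with \<open>y - x\<close>, the map becomes a real function
  with nonnegative derivative.
\<close>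

lemma monotone_if_derivative_nonneg:
  fixes f :: "'v::real_normed_vector \<Rightarrow> 'v" and ip :: "'v \<Rightarrow> 'v \<Rightarrow> real"
  assumes K: "convex K" and xy: "x \<in> K" "y \<in> K"
    and f: "\<And>z. z \<in> K \<Longrightarrow> (f has_derivative f' z) (at z)"
    and ip: "bounded_bilinear ip" and nonneg: "\<And>z v. z \<in> K \<Longrightarrow> 0 \<le> ip v (f' z v)"
  shows "0 \<le> ip (y - x) (f y - f x)"
proof -
  interpret bounded_bilinear ip by (rule ip)
  let ?l = "\<lambda>t. x + t *\<^sub>R (y - x)"
  let ?g = "\<lambda>t. ip (y - x) (f (?l t))"
  have "?g 0 \<le> ?g 1"
  proof (rule DERIV_nonneg_imp_nondecreasing[of 0 1 ?g])
    fix t :: real assume t: "0 \<le> t" "t \<le> 1"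
    have l: "?l t \<in> K" using convexD_alt[OF K xy, of t] t by (simp add: algebra_simps)
    have line: "(?l has_derivative (\<lambda>t. t *\<^sub>R (y - x))) (at t)"
      by (auto intro!: derivative_eq_intros)
    have "((\<lambda>t. f (?l t)) has_derivative (\<lambda>h. f' (?l t) (h *\<^sub>R (y - x)))) (at t)"
      by (rule has_derivative_compose[OF line f[OF l]])
    from bounded_linear.has_derivative[OF bounded_linear_right this, of "y - x"]
    have "(?g has_derivative (\<lambda>h. ip (y - x) (f' (?l t) (h *\<^sub>R (y - x))))) (at t)" .
    moreover have "ip (y - x) (f' (?l t) (h *\<^sub>R (y - x))) = ip (y - x) (f' (?l t) (y - x)) * h" for h
      by (simp add: linear_cmul[OF has_derivative_linear[OF f[OF l]]] scaleR_right)
    ultimately have "(?g has_real_derivative ip (y - x) (f' (?l t) (y - x))) (at t)"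
      by (simp add: has_field_derivative_def)
    then show "\<exists>d. (?g has_real_derivative d) (at t) \<and> 0 \<le> d" using nonneg[OF l] by blast
  qed simp
  then show ?thesis by (simp add: diff_right)
qed

section \<open>The weighted space of scenario-indexed maps\<close>

lemma linear_phi: "linear (phi p)"
  by (rule linearI) (simp_all add: phi_def vec_eq_iff algebra_simps)

definition phi_inverse :: "('s::finite \<Rightarrow> real) \<Rightarrow> real^('s \<times> 'n) \<Rightarrow> real^'n^'s" where
  "phi_inverse p x = (\<chi> s i. x $ (s, i) / sqrt (p s))"

lemma linear_phi_inverse: "linear (phi_inverse p)"
  by (rule linearI) (simp_all add: phi_inverse_def vec_eq_iff add_divide_distrib)

lemma phi_inverse_phi:
  assumes "\<And>s. p s > 0"
  shows "phi_inverse p (phi p x) = x"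
  using less_imp_neq[OF assms] by (simp add: phi_def phi_inverse_def vec_eq_iff)

lemma phi_phi_inverse:
  assumes "\<And>s. p s > 0"
  shows "phi p (phi_inverse p x) = x"
  using less_imp_neq[OF assms] by (simp add: phi_def phi_inverse_def vec_eq_iff)

text \<open>
  By \<open>Fhat_phi\<close>, \<open>Fhat\<close> is the superposition operator conjugated by the linear isomorphism \<open>phi\<close>, so
  the chain rule conjugates the derivative as well.
\<close>

lemma jacobian_Fhat:
  fixes p :: "'s::finite \<Rightarrow> real" and F :: "real^'n \<Rightarrow> 's \<Rightarrow> real^'n"
  assumes p: "\<And>s. p s > 0" and F: "(superpos F has_derivative D) (at z)"
  shows "jacobian (Fhat p F) (at (phi p z)) *v phi p v = phi p (D v)"
proof -
  have "Fhat p F = (\<lambda>x. phi p (superpos F (phi_inverse p x)))"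
    using Fhat_phi[of p F "phi_inverse p _", OF p] by (simp add: fun_eq_iff phi_phi_inverse[OF p])
  moreover have "(phi_inverse p has_derivative phi_inverse p) (at (phi p z))"
    by (simp add: linear_imp_has_derivative linear_phi_inverse)
  then have "((\<lambda>x. superpos F (phi_inverse p x)) has_derivative (\<lambda>x. D (phi_inverse p x))) (at (phi p z))"
    by (rule has_derivative_compose) (simp add: phi_inverse_phi[OF p] F)
  then have "((\<lambda>x. phi p (superpos F (phi_inverse p x))) has_derivative
      (\<lambda>x. phi p (D (phi_inverse p x)))) (at (phi p z))"
    by (rule has_derivative_compose) (simp add: linear_imp_has_derivative linear_phi)
  ultimately have der: "(Fhat p F has_derivative (\<lambda>x. phi p (D (phi_inverse p x)))) (at (phi p z))"
    by simp
  have "jacobian (Fhat p F) (at (phi p z)) = matrix (\<lambda>x. phi p (D (phi_inverse p x)))"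
    unfolding jacobian_def using frechet_derivative_at[OF der] by simp
  then show ?thesis
    by (simp add: matrix_vector_mul(2)[OF has_derivative_linear[OF der]] phi_inverse_phi[OF p])
qed

lemma bounded_bilinear_inner_w: "bounded_bilinear (inner_w (p :: 's::finite \<Rightarrow> real) :: real^'n::finite^'s \<Rightarrow> _)"
  unfolding bilinear_conv_bounded_bilinear[symmetric] bilinear_def inner_w_def
  by (auto intro!: linearI simp: inner_add_left inner_add_right algebra_simps sum.distrib sum_distrib_left)

lemma subspace_multipliers:
  fixes p :: "'s::finite \<Rightarrow> real" and stage :: "'n::finite \<Rightarrow> nat"
  assumes "\<And>s. p s > 0" and "range stage = {1..N}"
  shows "subspace (multipliers N stage p xi)"
proof -
  interpret bounded_bilinear "inner_w p :: real^'n^'s \<Rightarrow> _" by (rule bounded_bilinear_inner_w)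
  show ?thesis
    unfolding multipliers_eq_orthogonal_complement[OF assms] subspace_def
    by (auto simp: zero_right add_right scaleR_right)
qed

lemma closed_constraint_set:
  fixes C :: "'s::finite \<Rightarrow> (real^'n) set"
  assumes "\<And>s. closed (C s)"
  shows "closed (constraint_set C)"
proof -
  have "constraint_set C = (\<Inter>s. (\<lambda>x. x $ s) -` C s)" by (auto simp: constraint_set_def)
  then show ?thesis using assms by (auto intro!: closed_INT closed_vimage continuous_intros)
qed

lemma convex_constraint_set:
  fixes C :: "'s::finite \<Rightarrow> (real^'n) set"
  assumes "\<And>s. convex (C s)"
  shows "convex (constraint_set C)"
  using assms by (auto simp: convex_def constraint_set_def)

theorem theorem12:
  fixes N :: nat
    and stage :: "'n::finite \<Rightarrow> nat"
    and Xi :: "nat \<Rightarrow> 'a set"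
    and xi :: "'s::finite \<Rightarrow> nat \<Rightarrow> 'a"
    and p :: "'s \<Rightarrow> real"
    and C :: "'s \<Rightarrow> (real^'n) set"
    and F :: "real^'n \<Rightarrow> 's \<Rightarrow> real^'n"
    and C0 :: "(real^'n^'s) set"
    and e2 :: real
  assumes "N \<ge> 1"
    and "range stage = {1..N}"
    and "bij_betw xi UNIV (Pi\<^sub>E {1..N} Xi)"
    and "\<And>s. p s > 0"
    and "(\<Sum>s\<in>UNIV. p s) = 1"
    and "\<And>s. C s \<noteq> {} \<and> closed (C s) \<and> convex (C s)"
    and "constraint_set C \<subseteq> C0" and "open C0" and "convex C0"
    and "continuously_differentiable_on (superpos F) C0"
    and "pseudomonotone_on (inner_w p) C0 (superpos F)"
    and "\<And>x. x \<in> phi p ` C0 \<Longrightarrow>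
           transpose (jacobian (Fhat p F) (at x)) = jacobian (Fhat p F) (at x)"
    and "e2 > 0"
    and "\<And>x. x \<in> phi p ` C0 \<Longrightarrow>
           let A = jacobian (Fhat p F) (at x)
                   + e2 *\<^sub>R matrix (orth_proj (\<bullet>) (phi p ` multipliers N stage p xi))
           in eigen_multiplicity A (min_eigenvalue A) > 1"
  shows "\<forall>s\<ge>e2. globally_elicited (inner_w p) (multipliers N stage p xi)
           (\<lambda>x. {superpos F x + v | v. v \<in> normal_cone (inner_w p) (constraint_set C) x}) s"
proof -
  note stage = assms(2) and p = assms(4) and C = assms(6) and C0 = assms(7-9)
  let ?M = "multipliers N stage p xi"
  let ?ip = "inner_w p :: real^'n^'s \<Rightarrow> real^'n^'s \<Rightarrow> real"
  let ?P = "orth_proj ?ip ?M"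
  let ?Q = "orth_proj (\<bullet>) (phi p ` ?M)"
  obtain D where D: "\<And>x. x \<in> C0 \<Longrightarrow> (superpos F has_derivative blinfun_apply (D x)) (at x)"
    using assms(10) unfolding continuously_differentiable_on_def by blast
  note bil = bounded_bilinear_inner_w[of p]
  interpret ip: bounded_bilinear ?ip by (rule bil)
  have iso: "phi p x \<bullet> phi p y = ?ip x y" for x y by (rule phi_isometry[OF p])
  have inj: "inj (phi p :: real^'n^'s \<Rightarrow> _)" by (intro inj_on_inverseI[of _ "phi_inverse p"] phi_inverse_phi p)
  have subM: "subspace ?M" by (rule subspace_multipliers[OF p stage])
  have sub: "subspace (phi p ` ?M)" by (rule linear_subspace_image[OF linear_phi subM])
  have P: "phi p (?P x) = ?Q (phi p x)" for x
    by (rule orth_proj_isometry[OF iso linear_phi inj subM])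
  have "?P = (\<lambda>x. phi_inverse p (?Q (phi p x)))"
    by (simp add: P[symmetric] phi_inverse_phi[OF p])
  then have linP: "linear ?P"
    using linear_compose[OF linear_compose[OF linear_phi linear_orth_proj[OF sub]] linear_phi_inverse]
    by (simp add: o_def)
  have P_nonneg: "0 \<le> ?ip v (?P v)" for v
    using orth_proj_self_adjoint[OF sub, of "phi p v" "phi p v"] by (simp add: iso[symmetric] P)
  \<comment> \<open>This is the positive semidefiniteness of the Jacobian plus \<open>e2\<close> times the projection, pulled
      back along \<open>phi\<close> to the weighted space.\<close>
  have psd: "0 \<le> ?ip v (blinfun_apply (D z) v) + e2 * ?ip v (?P v)" if z: "z \<in> C0" for z v
  proof -
    let ?J = "jacobian (Fhat p F) (at (phi p z))"
    let ?A = "?J + e2 *\<^sub>R matrix ?Q"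
    have A: "phi p u \<bullet> (?A *v phi p u) = ?ip u (blinfun_apply (D z) u) + e2 * ?ip u (?P u)" for u
      by (simp add: matrix_vector_mult_add_rdistrib scaleR_matrix_vector_assoc[symmetric]
          jacobian_Fhat[OF p D[OF z]] matrix_vector_mul(2)[OF linear_orth_proj[OF sub]] P[symmetric]
          inner_add_right iso)
    have "transpose ?A = ?A"
      using assms(12)[OF imageI[OF z]] transpose_matrix_orth_proj[OF sub]
      by (simp add: transpose_def vec_eq_iff)
    moreover have "eigen_multiplicity ?A (min_eigenvalue ?A) > 1"
      using assms(14)[OF imageI[OF z]] by (simp add: Let_def)
    moreover have "0 \<le> w \<bullet> (?A *v w)" if w: "phi p (superpos F z) \<bullet> w = 0" for w
    proof -
      define u where "u = phi_inverse p w"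
      have u: "w = phi p u" by (simp add: u_def phi_phi_inverse[OF p])
      have "?ip u (superpos F z) = 0" using w by (simp add: u inner_commute iso[symmetric])
      then have "0 \<le> ?ip u (blinfun_apply (D z) u)"
        by (rule pseudomonotone_derivative_nonneg[OF assms(11) C0(2) z D[OF z] bil])
      then show ?thesis unfolding u A using P_nonneg[of u] \<open>e2 > 0\<close> by simp
    qed
    ultimately have "0 \<le> phi p v \<bullet> (?A *v phi p v)"
      by (rule positive_semidefinite_if_on_hyperplane)
    then show ?thesis by (simp only: A)
  qed
  show ?thesis
  proof (intro allI impI)
    fix s assume s: "e2 \<le> s"
    define G where "G = (\<lambda>x. superpos F x + s *\<^sub>R ?P x)"
    have G': "(G has_derivative (\<lambda>v. blinfun_apply (D z) v + s *\<^sub>R ?P v)) (at z)" if "z \<in> C0" for z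
      unfolding G_def
      by (intro has_derivative_add D that has_derivative_scaleR_right linear_imp_has_derivative linP)
    have G'_nonneg: "0 \<le> ?ip v (blinfun_apply (D z) v + s *\<^sub>R ?P v)" if "z \<in> C0" for z v
      using psd[OF that, of v] mult_right_mono[OF s P_nonneg[of v]]
      by (simp add: ip.add_right ip.scaleR_right)
    have "continuous_on (constraint_set C) G"
      using C0(1) by (intro continuous_at_imp_continuous_on ballI has_derivative_continuous[OF G']) auto
    moreover have "0 \<le> ?ip (y - x) (G y - G x)" if "x \<in> constraint_set C" "y \<in> constraint_set C" for x y
      using that C0(1)
      by (intro monotone_if_derivative_nonneg[OF C0(3) _ _ G' bil G'_nonneg]) auto
    \<comment> \<open>Multiplication by the probabilities represents the weighted inner product.\<close>
    moreover have "linear (\<lambda>x :: real^'n^'s. \<chi> s. p s *\<^sub>R x $ s)"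
      by (rule linearI) (simp_all add: vec_eq_iff algebra_simps)
    moreover have "?ip x y = (\<chi> s. p s *\<^sub>R x $ s) \<bullet> y" for x y
      by (simp add: inner_w_def inner_vec_def sum_distrib_left mult.assoc)
    moreover have "?ip x y = ?ip y x" for x y by (simp add: iso[symmetric] inner_commute)
    moreover have "Min (range p) > 0" using p by (auto simp: Min_gr_iff)
    moreover have "Min (range p) * (norm x)\<^sup>2 \<le> ?ip x x" for x :: "real^'n^'s"
      unfolding power2_norm_eq_inner inner_vec_def[of x] inner_w_def sum_distrib_left
      by (intro sum_mono mult_right_mono Min_le) auto
    moreover have "closed (constraint_set C)" "convex (constraint_set C)"
      using C by (auto intro: closed_constraint_set convex_constraint_set)
    moreover have "constraint_set C \<noteq> {}"
    proof -
      have "(\<chi> s. SOME a. a \<in> C s) \<in> constraint_set C"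
        using C by (simp add: constraint_set_def some_in_eq)
      then show ?thesis by blast
    qed
    ultimately have "maximal_monotone_map ?ip (\<lambda>x. {G x + v | v. v \<in> normal_cone ?ip (constraint_set C) x})"
      by (intro maximal_monotone_add_normal_cone[where W = "\<lambda>x. \<chi> s. p s *\<^sub>R x $ s"])
    also have "(\<lambda>x. {G x + v | v. v \<in> normal_cone ?ip (constraint_set C) x}) =
      (\<lambda>x. {u + s *\<^sub>R ?P x | u. u \<in> {superpos F x + v | v. v \<in> normal_cone ?ip (constraint_set C) x}})"
      by (rule ext) (force simp: G_def algebra_simps)
    finally show "globally_elicited ?ip ?M
        (\<lambda>x. {superpos F x + v | v. v \<in> normal_cone ?ip (constraint_set C) x}) s"
      using s \<open>e2 > 0\<close> by (simp add: globally_elicited_def)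
  qed
qed

end
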